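(* For every positive integer $k$, there are graphs $G_k$ and $H_k$ such that $\chi_{\nleftrightarrow}(G_k) - \mathrm{ch}(G_k) \geq k$ and $\mathrm{ch}(H_k) - \chi_{\nleftrightarrow}(H_k) \geq k$.
   Context: Graphs are finite and simple. $\mathrm{ch}(G)$ denotes the choice number (list-chromatic number) of $G$: the minimum $k$ such that for every assignment of lists $L(v)$ of at least $k$ colors to the vertices, $G$ has a proper vertex coloring $\varphi$ with $\varphi(v)\in L(v)$ for all $v$. A local $k$-partition of a graph $G$ is a collection $\{c_v\}_{v\in V(G)}$ of maps $c_v : E(v)\to\{1,\dots,k\}$, where $E(v)$ is the set of edges incident with $v$. $G$ is conflict $\{c_v\}$-colorable if there is a map $\varphi : V(G)\to\{1,\dots,k\}$ such that no edge $e=xy$ satisfies both $\varphi(x)=c_x(e)$ and $\varphi(y)=c_y(e)$. The single conflict chromatic number $\chi_{\nleftrightarrow}(G)$ is the smallest $k$ such that $G$ is conflict $\{c_v\}$-colorable for every local $k$-partition $\{c_v\}$. *)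

theory Defs
  imports Main "HOL-Library.FuncSet"
begin

(* A graph is a nonempty finite vertex set V together with a set E of two-element subsets of V. *)
definition simple_graph :: "'a set \<Rightarrow> 'a set set \<Rightarrow> bool" where
  "simple_graph V E \<longleftrightarrow> finite V \<and> V \<noteq> {} \<and> (\<forall>e\<in>E. e \<subseteq> V \<and> card e = 2)"

definition proper_coloring :: "'a set set \<Rightarrow> ('a \<Rightarrow> 'c) \<Rightarrow> bool" where
  "proper_coloring E \<phi> \<longleftrightarrow> (\<forall>x y. {x, y} \<in> E \<longrightarrow> \<phi> x \<noteq> \<phi> y)"

(* Colors are natural numbers: only finitely many colors occur in finite lists on a finite graph,
   so this is no restriction. Lists are finite; card would be 0 on an infinite set. *)
definition choosable :: "'a set \<Rightarrow> 'a set set \<Rightarrow> nat \<Rightarrow> bool" where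
  "choosable V E k \<longleftrightarrow>
     (\<forall>L :: 'a \<Rightarrow> nat set. (\<forall>v\<in>V. finite (L v) \<and> k \<le> card (L v)) \<longrightarrow>
        (\<exists>\<phi>. (\<forall>v\<in>V. \<phi> v \<in> L v) \<and> proper_coloring E \<phi>))"

definition choice_number :: "'a set \<Rightarrow> 'a set set \<Rightarrow> nat" where
  "choice_number V E = (LEAST k. choosable V E k)"

definition incident_edges :: "'a set set \<Rightarrow> 'a \<Rightarrow> 'a set set" where
  "incident_edges E v = {e \<in> E. v \<in> e}"

definition local_partition ::
  "'a set \<Rightarrow> 'a set set \<Rightarrow> nat \<Rightarrow> ('a \<Rightarrow> 'a set \<Rightarrow> nat) \<Rightarrow> bool" where
  "local_partition V E k c \<longleftrightarrow> (\<forall>v\<in>V. c v \<in> incident_edges E v \<rightarrow> {1..k})"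

definition conflict_colorable ::
  "'a set \<Rightarrow> 'a set set \<Rightarrow> nat \<Rightarrow> ('a \<Rightarrow> 'a set \<Rightarrow> nat) \<Rightarrow> bool" where
  "conflict_colorable V E k c \<longleftrightarrow>
     (\<exists>\<phi> \<in> V \<rightarrow> {1..k}.
        \<not> (\<exists>x y. {x, y} \<in> E \<and> \<phi> x = c x {x, y} \<and> \<phi> y = c y {x, y}))"

(* The restriction to k \<ge> 1 is essential: a graph with an edge has no local 0-partition,
   so k = 0 would satisfy the condition vacuously. *)
definition single_conflict_chromatic_number :: "'a set \<Rightarrow> 'a set set \<Rightarrow> nat" where
  "single_conflict_chromatic_number V E =
     (LEAST k. 1 \<le> k \<and> (\<forall>c. local_partition V E k c \<longrightarrow> conflict_colorable V E k c))"

end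

theory Submission
  imports Complex_Main Defs
begin

text \<open>
  Everything is a first-moment argument. A uniformly random map into
  \<open>k\<close> colours violates a given edge with probability \<open>1/k\<^sup>2\<close>, so \<open>|E| < k\<^sup>2\<close> forces the
  single conflict chromatic number to be at most \<open>k\<close>; for \<open>H = K\<^bsub>4k\<^esub>\<close> it is at most \<open>3k\<close>, while
  the choice number is \<open>4k\<close>. Conversely, when the constraint at each edge is chosen in turn so
  as to kill a fraction \<open>1/q\<^sup>2\<close> of the surviving maps, no map survives as soon as
  \<open>(1 - 1/q\<^sup>2)^|E| * q^|V| < 1\<close>. For \<open>G = K\<^bsub>n,n\<^esub>\<close> with \<open>n = 2 * Q^3\<close> this makes the
  single conflict chromatic number exceed \<open>Q\<close>, while splitting the colours randomly between the
  two sides shows that the choice number is only logarithmic in \<open>Q\<close>.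
\<close>

section \<open>Upper bound for the single conflict chromatic number by a union bound over
  edges\<close>

lemma simple_graph_finite_edges:
  assumes "simple_graph V E"
  shows "finite E"
proof (rule finite_subset)
  show "E \<subseteq> Pow V" using assms by (auto simp: simple_graph_def)
  show "finite (Pow V)" using assms by (simp add: simple_graph_def)
qed

text \<open>Passes from ordered endpoint pairs to edges as sets, so that each edge contributes
  exactly one event to the counts below.\<close>

lemma conflict_colorable_iff:
  assumes "simple_graph V E"
  shows "conflict_colorable V E k c \<longleftrightarrow>
    (\<exists>\<phi> \<in> V \<rightarrow> {1..k}. \<forall>e\<in>E. \<exists>v\<in>e. \<phi> v \<noteq> c v e)"
proof -
  have eq: "(\<exists>x y. {x, y} \<in> E \<and> \<phi> x = c x {x, y} \<and> \<phi> y = c y {x, y})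
    \<longleftrightarrow> (\<exists>e\<in>E. \<forall>v\<in>e. \<phi> v = c v e)" (is "?L = ?R") for \<phi>
  proof
    assume ?L
    then obtain x y where "{x, y} \<in> E" "\<phi> x = c x {x, y}" "\<phi> y = c y {x, y}" by blast
    then show ?R by (intro bexI[of _ "{x, y}"]) auto
  next
    assume ?R
    then obtain e where e: "e \<in> E" "\<forall>v\<in>e. \<phi> v = c v e" by blast
    have "card e = 2" using assms e(1) by (simp add: simple_graph_def)
    then obtain x y where "e = {x, y}" by (meson card_2_iff)
    with e have "{x, y} \<in> E \<and> \<phi> x = c x {x, y} \<and> \<phi> y = c y {x, y}" by simp
    then show ?L by blast
  qed
  show ?thesis unfolding conflict_colorable_def eq by simp
qed

text \<open>The two endpoints are pinned and the remaining vertices are free. Extensional maps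
  represent each map on \<open>V\<close> exactly once, which makes counting possible.\<close>

lemma card_maps_violating_edge:
  assumes "finite V" "e \<subseteq> V" "card e = 2" "\<forall>v\<in>e. c v \<in> {1..k}"
  shows "card {\<phi> \<in> V \<rightarrow>\<^sub>E {1..k}. \<forall>v\<in>e. \<phi> v = c v} = k ^ (card V - 2)"
proof -
  have "{\<phi> \<in> V \<rightarrow>\<^sub>E {1..k}. \<forall>v\<in>e. \<phi> v = c v} = (\<Pi>\<^sub>E v\<in>V. if v \<in> e then {c v} else {1..k})"
    (is "?A = ?B")
  proof
    show "?A \<subseteq> ?B" by (auto simp: PiE_iff extensional_def)
    show "?B \<subseteq> ?A"
    proof
      fix \<phi> assume \<phi>: "\<phi> \<in> ?B"
      have "\<phi> v \<in> {1..k}" if "v \<in> V" for v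
        using PiE_mem[OF \<phi> that] assms(4) by (auto split: if_splits)
      moreover have "\<phi> v = c v" if "v \<in> e" for v
        using PiE_mem[OF \<phi>, of v] that assms(2) by auto
      moreover have "\<phi> \<in> extensional V" using \<phi> by (simp add: PiE_iff)
      ultimately show "\<phi> \<in> ?A" by (auto simp: PiE_iff)
    qed
  qed
  then have "card ?A = (\<Prod>v\<in>V. card (if v \<in> e then {c v} else {1..k}))"
    using card_PiE[OF assms(1)] by simp
  also have "\<dots> = (\<Prod>v\<in>V. if v \<in> e then 1 else k)"
    by (intro prod.cong) auto
  also have "\<dots> = k ^ card (V - e)"
    using assms(1) by (subst prod.If_cases) (auto simp: Diff_eq)
  also have "card (V - e) = card V - 2"
    using assms by (simp add: card_Diff_subset finite_subset)
  finally show ?thesis .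
qed

text \<open>Each edge rules out \<open>k ^ (card V - 2)\<close> of the \<open>k ^ card V\<close>
  maps, so fewer than \<open>k\<^sup>2\<close> edges cannot rule out all of them.\<close>

lemma conflict_colorable_if_few_edges:
  assumes "simple_graph V E" "card E < k\<^sup>2" "local_partition V E k c"
  shows "conflict_colorable V E k c"
proof (cases "E = {}")
  case True
  have "1 \<le> k" using assms(2) by (cases k) auto
  with True show ?thesis
    unfolding conflict_colorable_iff[OF assms(1)] by (intro bexI[of _ "\<lambda>_. 1"]) auto
next
  case False
  have V: "finite V" and edge: "\<And>e. e \<in> E \<Longrightarrow> e \<subseteq> V \<and> card e = 2"
    using assms(1) by (auto simp: simple_graph_def)
  \<comment> \<open>The presence of an edge keeps the truncated subtraction in
    \<open>card V - 2\<close> honest; this is why the edgeless case is split off.\<close>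
  have "2 \<le> card V"
  proof -
    obtain e where "e \<in> E" using False by blast
    then show ?thesis using edge[of e] card_mono[OF V, of e] by simp
  qed
  have k: "0 < k" using assms(2) by (cases k) auto
  define bad where "bad e = {\<phi> \<in> V \<rightarrow>\<^sub>E {1..k}. \<forall>v\<in>e. \<phi> v = c v e}" for e
  have card_bad: "card (bad e) = k ^ (card V - 2)" if "e \<in> E" for e
  proof -
    have "\<forall>v\<in>e. c v e \<in> {1..k}"
      using assms(3) edge[OF that] that
      unfolding local_partition_def incident_edges_def by blast
    then show ?thesis
      unfolding bad_def using card_maps_violating_edge[OF V, of e "\<lambda>v. c v e" k] edge[OF that] by blast
  qed
  have "card (\<Union>(bad ` E)) \<le> (\<Sum>e\<in>E. card (bad e))"
    by (rule card_UN_le[OF simple_graph_finite_edges[OF assms(1)]])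
  also have "\<dots> = card E * k ^ (card V - 2)" by (simp add: card_bad)
  also have "\<dots> < k\<^sup>2 * k ^ (card V - 2)" using assms(2) k by simp
  also have "\<dots> = k ^ card V" using \<open>2 \<le> card V\<close>
    by (simp only: power_add[symmetric] le_add_diff_inverse)
  also have "\<dots> = card (V \<rightarrow>\<^sub>E {1..k})" using V by (simp add: card_PiE)
  finally have less: "card (\<Union>(bad ` E)) < card (V \<rightarrow>\<^sub>E {1..k})" .
  have "\<Union>(bad ` E) \<subseteq> V \<rightarrow>\<^sub>E {1..k}" unfolding bad_def by blast
  moreover have "finite (V \<rightarrow>\<^sub>E {1..k})" using V by (intro finite_PiE) auto
  ultimately have "finite (\<Union>(bad ` E))" by (rule finite_subset)
  then have "\<not> V \<rightarrow>\<^sub>E {1..k} \<subseteq> \<Union>(bad ` E)"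
    using less card_mono leD by blast
  then obtain \<phi> where "\<phi> \<in> V \<rightarrow>\<^sub>E {1..k}" "\<phi> \<notin> \<Union>(bad ` E)" by blast
  then have "\<phi> \<in> V \<rightarrow> {1..k}" "\<forall>e\<in>E. \<exists>v\<in>e. \<phi> v \<noteq> c v e"
    by (auto simp: bad_def)
  then show ?thesis unfolding conflict_colorable_iff[OF assms(1)] by blast
qed

lemma single_conflict_chromatic_number_le:
  assumes "simple_graph V E" "card E < k\<^sup>2"
  shows "single_conflict_chromatic_number V E \<le> k"
proof -
  have "1 \<le> k" using assms(2) by (cases k) auto
  then show ?thesis
    unfolding single_conflict_chromatic_number_def
    using conflict_colorable_if_few_edges[OF assms] by (intro Least_le) blast
qed

section \<open>Lower bound for the single conflict chromatic number by adversarial local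
  partitions\<close>

text \<open>Pigeonhole: the \<open>q\<^sup>2\<close> color patterns on the endpoints of
  \<open>e\<close> split \<open>S\<close> into fibers, and some fiber has at least average
  size.\<close>

lemma ex_large_edge_fiber:
  fixes S :: "('a \<Rightarrow> nat) set"
  assumes "finite S" "card e = 2" "\<forall>\<phi>\<in>S. \<forall>v\<in>e. \<phi> v \<in> {1..q}" "1 \<le> q"
  obtains d where "\<forall>v. d v \<in> {1..q}" "card S \<le> q\<^sup>2 * card {\<phi> \<in> S. \<forall>v\<in>e. \<phi> v = d v}"
proof -
  obtain x y where e: "e = {x, y}" "x \<noteq> y" using assms(2) by (auto simp: card_2_iff)
  define fib where "fib = (\<lambda>(i, j). {\<phi> \<in> S. \<phi> x = i \<and> \<phi> y = j})"
  let ?P = "{1..q} \<times> {1..q}"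
  have "\<exists>p\<in>?P. card S \<le> q\<^sup>2 * card (fib p)"
  proof (rule ccontr)
    assume "\<not> ?thesis"
    then have small: "\<forall>p\<in>?P. q\<^sup>2 * card (fib p) < card S" by force
    have "S = \<Union>(fib ` ?P)" using assms(3) e by (auto simp: fib_def)
    then have "card S \<le> (\<Sum>p\<in>?P. card (fib p))" using card_UN_le[of ?P fib] by simp
    then have "q\<^sup>2 * card S \<le> (\<Sum>p\<in>?P. q\<^sup>2 * card (fib p))"
      unfolding sum_distrib_left[symmetric] by (rule mult_le_mono2)
    also have "\<dots> < (\<Sum>p\<in>?P. card S)"
      using small assms(4) by (intro sum_strict_mono) auto
    also have "\<dots> = q\<^sup>2 * card S" by (simp add: power2_eq_square)
    finally show False by simp
  qed
  then obtain i j where ij: "i \<in> {1..q}" "j \<in> {1..q}" "card S \<le> q\<^sup>2 * card (fib (i, j))" by auto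
  \<comment> \<open>Off \<open>e\<close> the value \<open>j\<close> is only a filler that keeps the
    function inside \<open>{1..q}\<close> everywhere.\<close>
  have "fib (i, j) = {\<phi> \<in> S. \<forall>v\<in>e. \<phi> v = (if v = x then i else j)}"
    using e by (auto simp: fib_def)
  then show ?thesis using ij that[of "\<lambda>v. if v = x then i else j"] by auto
qed

text \<open>The edges are treated one at a time. For each new edge the forbidden pattern is the one
  most popular among the maps still alive, so at least a fraction \<open>1 / q\<^sup>2\<close> of
  them dies.\<close>

lemma ex_partition_few_survivors:
  fixes S :: "('a \<Rightarrow> nat) set"
  assumes "finite F" "finite S" "\<forall>e\<in>F. card e = 2"
    "\<forall>\<phi>\<in>S. \<forall>e\<in>F. \<forall>v\<in>e. \<phi> v \<in> {1..q}" "1 \<le> q"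
  shows "\<exists>c. (\<forall>v e. c v e \<in> {1..q}) \<and>
    real (card {\<phi> \<in> S. \<forall>e\<in>F. \<exists>v\<in>e. \<phi> v \<noteq> c v e}) \<le> (1 - 1 / (real q)\<^sup>2) ^ card F * card S"
  using assms(1,3,4)
proof (induction F rule: finite_induct)
  case empty
  then show ?case using assms(5) by (intro exI[of _ "\<lambda>_ _. 1"]) auto
next
  case (insert e F)
  then obtain c where c: "\<forall>v e. c v e \<in> {1..q}"
    and le: "real (card {\<phi> \<in> S. \<forall>e\<in>F. \<exists>v\<in>e. \<phi> v \<noteq> c v e})
      \<le> (1 - 1 / (real q)\<^sup>2) ^ card F * card S"
    by auto
  define T where "T = {\<phi> \<in> S. \<forall>e\<in>F. \<exists>v\<in>e. \<phi> v \<noteq> c v e}"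
  have T: "finite T" "T \<subseteq> S" using assms(2) by (auto simp: T_def)
  obtain d where d: "\<forall>v. d v \<in> {1..q}"
    and large: "card T \<le> q\<^sup>2 * card {\<phi> \<in> T. \<forall>v\<in>e. \<phi> v = d v}"
    using ex_large_edge_fiber[OF T(1), of e q] insert.prems T(2) assms(5) by blast
  define D where "D = {\<phi> \<in> T. \<forall>v\<in>e. \<phi> v = d v}"
  \<comment> \<open>A local partition may be set independently at each edge; since \<open>e\<close>
    is not in \<open>F\<close>, the earlier constraints are unchanged.\<close>
  define c' where "c' = (\<lambda>v f. if f = e then d v else c v f)"
  have "{\<phi> \<in> S. \<forall>f\<in>insert e F. \<exists>v\<in>f. \<phi> v \<noteq> c' v f} = T - D"
    using insert.hyps(2) by (auto simp: T_def D_def c'_def)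
  moreover have "card (T - D) = card T - card D" "card D \<le> card T"
    using T(1) by (auto simp: D_def intro!: card_Diff_subset card_mono)
  ultimately have "real (card {\<phi> \<in> S. \<forall>f\<in>insert e F. \<exists>v\<in>f. \<phi> v \<noteq> c' v f}) = card T - card D"
    by simp
  also have "\<dots> \<le> (1 - 1 / (real q)\<^sup>2) * card T"
  proof -
    have "real (card T) \<le> (real q)\<^sup>2 * card D"
      using large unfolding D_def by (simp flip: of_nat_power of_nat_mult)
    then have "card T / (real q)\<^sup>2 \<le> card D"
      using assms(5) by (simp add: field_simps)
    then show ?thesis using \<open>card D \<le> card T\<close> by (simp add: algebra_simps)
  qed
  also have "\<dots> \<le> (1 - 1 / (real q)\<^sup>2) * ((1 - 1 / (real q)\<^sup>2) ^ card F * card S)"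
    using le assms(5) unfolding T_def by (intro mult_left_mono) auto
  also have "\<dots> = (1 - 1 / (real q)\<^sup>2) ^ card (insert e F) * card S"
    using insert.hyps by simp
  finally show ?case using c d by (intro exI[of _ c']) (auto simp: c'_def)
qed

text \<open>Starting from all \<open>q ^ card V\<close> maps, the number of survivors is an integer
  below 1, hence zero.\<close>

lemma ex_partition_not_conflict_colorable:
  assumes "simple_graph V E" "1 \<le> q" "(1 - 1 / (real q)\<^sup>2) ^ card E * real q ^ card V < 1"
  shows "\<exists>c. local_partition V E q c \<and> \<not> conflict_colorable V E q c"
proof -
  have V: "finite V" and edge: "\<And>e. e \<in> E \<Longrightarrow> e \<subseteq> V \<and> card e = 2"
    using assms(1) by (auto simp: simple_graph_def)
  let ?S = "V \<rightarrow>\<^sub>E {1..q}"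
  have "finite ?S" using V by (intro finite_PiE) auto
  moreover have "\<forall>\<phi>\<in>?S. \<forall>e\<in>E. \<forall>v\<in>e. \<phi> v \<in> {1..q}" using edge by blast
  ultimately obtain c where c: "\<forall>v e. c v e \<in> {1..q}"
    and le: "real (card {\<phi> \<in> ?S. \<forall>e\<in>E. \<exists>v\<in>e. \<phi> v \<noteq> c v e})
      \<le> (1 - 1 / (real q)\<^sup>2) ^ card E * card ?S"
    using ex_partition_few_survivors[OF simple_graph_finite_edges[OF assms(1)], of ?S q]
      assms(2) edge by blast
  have "card ?S = q ^ card V" using V by (simp add: card_PiE)
  with le assms(3) have "card {\<phi> \<in> ?S. \<forall>e\<in>E. \<exists>v\<in>e. \<phi> v \<noteq> c v e} = 0" by simp
  then have none: "\<not> (\<exists>\<phi>\<in>?S. \<forall>e\<in>E. \<exists>v\<in>e. \<phi> v \<noteq> c v e)"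
    using \<open>finite ?S\<close> by auto
  have "\<not> conflict_colorable V E q c"
  proof
    assume "conflict_colorable V E q c"
    then obtain \<phi> where \<phi>: "\<phi> \<in> V \<rightarrow> {1..q}" "\<forall>e\<in>E. \<exists>v\<in>e. \<phi> v \<noteq> c v e"
      unfolding conflict_colorable_iff[OF assms(1)] by blast
    \<comment> \<open>A conflict coloring may take any values off \<open>V\<close>, while only
      extensional maps were counted. Edges lie inside \<open>V\<close>, so restricting changes no
      constraint.\<close>
    have "restrict \<phi> V \<in> ?S" using \<phi>(1) by auto
    moreover have "\<forall>e\<in>E. \<exists>v\<in>e. restrict \<phi> V v \<noteq> c v e"
    proof
      fix e assume e: "e \<in> E"
      then obtain v where "v \<in> e" "\<phi> v \<noteq> c v e" using \<phi>(2) by blast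
      then show "\<exists>v\<in>e. restrict \<phi> V v \<noteq> c v e" using edge[OF e] by (intro bexI[of _ v]) auto
    qed
    ultimately show False using none by blast
  qed
  moreover have "local_partition V E q c" using c by (simp add: local_partition_def)
  ultimately show ?thesis by blast
qed

text \<open>The bound is assumed for every \<open>q\<close> up to \<open>Q\<close>, so each
  candidate value for the \<open>LEAST\<close> is refuted directly.\<close>

lemma single_conflict_chromatic_number_gt:
  assumes "simple_graph V E"
    "\<And>q. 1 \<le> q \<Longrightarrow> q \<le> Q \<Longrightarrow> (1 - 1 / (real q)\<^sup>2) ^ card E * real q ^ card V < 1"
  shows "Q < single_conflict_chromatic_number V E"
proof -
  let ?P = "\<lambda>k. 1 \<le> k \<and> (\<forall>c. local_partition V E k c \<longrightarrow> conflict_colorable V E k c)"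
  \<comment> \<open>Some value must be admissible for the \<open>LEAST\<close> to be attained; by
    the union bound \<open>card E + 1\<close> is one.\<close>
  have "card E < (card E + 1)\<^sup>2" by (simp add: power2_eq_square)
  then have "?P (card E + 1)" using conflict_colorable_if_few_edges[OF assms(1)] by simp
  then have P: "?P (single_conflict_chromatic_number V E)"
    unfolding single_conflict_chromatic_number_def by (rule LeastI[of ?P])
  show ?thesis
  proof (rule ccontr)
    let ?q = "single_conflict_chromatic_number V E"
    assume "\<not> Q < ?q"
    then have "?q \<le> Q" by simp
    obtain c where "local_partition V E ?q c" "\<not> conflict_colorable V E ?q c"
      using ex_partition_not_conflict_colorable[OF assms(1) conjunct1[OF P]
          assms(2)[OF conjunct1[OF P] \<open>?q \<le> Q\<close>]] by blast
    then show False using conjunct2[OF P] by blast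
  qed
qed

section \<open>Choice numbers: attainment of the minimum and complete graphs\<close>

text \<open>Greedy choice: the vertices already treated use fewer colors than the next list
  contains.\<close>

lemma ex_distinct_representatives:
  assumes "finite V" "\<forall>v\<in>V. finite (L v) \<and> card V \<le> card (L v)"
  shows "\<exists>\<phi>. (\<forall>v\<in>V. \<phi> v \<in> L v) \<and> inj_on \<phi> V"
  using assms
proof (induction V rule: finite_induct)
  case empty
  then show ?case by simp
next
  case (insert v V)
  have L: "finite (L u) \<and> Suc (card V) \<le> card (L u)" if "u \<in> insert v V" for u
    using insert.prems insert.hyps that by auto
  then have "\<forall>u\<in>V. finite (L u) \<and> card V \<le> card (L u)" using Suc_leD by blast
  then obtain \<phi> where \<phi>: "\<forall>v\<in>V. \<phi> v \<in> L v" "inj_on \<phi> V" using insert.IH by blast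
  have "card (\<phi> ` V) < card (L v)" using L[of v] card_image_le[OF insert.hyps(1), of \<phi>] by simp
  then have "\<not> L v \<subseteq> \<phi> ` V" using insert.hyps(1) card_mono[of "\<phi> ` V" "L v"] by auto
  then obtain a where "a \<in> L v" "a \<notin> \<phi> ` V" by blast
  with \<phi> insert.hyps(2) have "(\<forall>u\<in>insert v V. (\<phi>(v := a)) u \<in> L u) \<and> inj_on (\<phi>(v := a)) (insert v V)"
    by (auto simp: inj_on_def)
  then show ?case by (intro exI[of _ "\<phi>(v := a)"])
qed

text \<open>An injective choice from the lists is proper on every graph. This guarantees that the
  \<open>LEAST\<close> in \<open>choice_number\<close> is attained.\<close>

lemma choosable_card_vertices:
  assumes "simple_graph V E"
  shows "choosable V E (card V)"
  unfolding choosable_def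
proof (intro allI impI)
  fix L :: "'a \<Rightarrow> nat set" assume L: "\<forall>v\<in>V. finite (L v) \<and> card V \<le> card (L v)"
  have "finite V" using assms by (simp add: simple_graph_def)
  then obtain \<phi> where \<phi>: "\<forall>v\<in>V. \<phi> v \<in> L v" "inj_on \<phi> V"
    using ex_distinct_representatives[OF _ L] by blast
  have "proper_coloring E \<phi>"
    unfolding proper_coloring_def
  proof (intro allI impI)
    fix x y assume "{x, y} \<in> E"
    then have xy: "{x, y} \<subseteq> V" "card {x, y} = 2"
      using assms unfolding simple_graph_def by blast+
    then have "x \<noteq> y" by (cases "x = y") simp_all
    then show "\<phi> x \<noteq> \<phi> y" using xy(1) inj_onD[OF \<phi>(2)] by blast
  qed
  with \<phi>(1) show "\<exists>\<phi>. (\<forall>v\<in>V. \<phi> v \<in> L v) \<and> proper_coloring E \<phi>" by blast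
qed

lemma choosable_choice_number:
  assumes "simple_graph V E"
  shows "choosable V E (choice_number V E)"
  unfolding choice_number_def
  using choosable_card_vertices[OF assms] by (rule LeastI[of "choosable V E"])

lemma choosableD:
  fixes L :: "'a \<Rightarrow> nat set"
  assumes "choosable V E k" "\<And>v. v \<in> V \<Longrightarrow> finite (L v)" "\<And>v. v \<in> V \<Longrightarrow> k \<le> card (L v)"
  shows "\<exists>\<phi>. (\<forall>v\<in>V. \<phi> v \<in> L v) \<and> proper_coloring E \<phi>"
  using assms(1)[unfolded choosable_def, THEN spec[of _ L]] assms(2,3) by blast

text \<open>Identical lists suffice: a proper coloring of a complete graph is injective, so the
  common list has at least \<open>card V\<close> colors.\<close>

lemma choice_number_complete_graph_ge:
  assumes "finite V" "V \<noteq> {}"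
  shows "card V \<le> choice_number V {e. e \<subseteq> V \<and> card e = 2}" (is "_ \<le> choice_number V ?E")
proof -
  have "simple_graph V ?E" using assms by (auto simp: simple_graph_def)
  then have "choosable V ?E (choice_number V ?E)" by (rule choosable_choice_number)
  then have "\<exists>\<phi>. (\<forall>v\<in>V. \<phi> v \<in> {0..<choice_number V ?E}) \<and> proper_coloring ?E \<phi>"
    by (rule choosableD) simp_all
  then obtain \<phi> where \<phi>: "\<forall>v\<in>V. \<phi> v \<in> {0..<choice_number V ?E}" "proper_coloring ?E \<phi>"
    by blast
  have "inj_on \<phi> V"
  proof (rule inj_onI, rule ccontr)
    fix x y assume "x \<in> V" "y \<in> V" "\<phi> x = \<phi> y" "x \<noteq> y"
    then have "{x, y} \<in> ?E" by simp
    then show False using \<phi>(2) \<open>\<phi> x = \<phi> y\<close> by (auto simp: proper_coloring_def)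
  qed
  moreover have "\<phi> ` V \<subseteq> {0..<choice_number V ?E}" using \<phi>(1) by blast
  ultimately have "card V \<le> card {0..<choice_number V ?E}"
    by (rule card_inj_on_le) (rule finite_atLeastLessThan)
  then show ?thesis by (simp only: card_atLeastLessThan diff_zero)
qed

section \<open>Choosability of bipartite graphs by random splitting of the colors\<close>

text \<open>In probabilistic terms, a uniformly random subset of \<open>C\<close> misses
  \<open>L\<close> with probability at most \<open>1 / 2 ^ m\<close>.\<close>

lemma card_subsets_avoiding:
  assumes "finite C" "L \<subseteq> C" "m \<le> card L"
  shows "card {P. P \<subseteq> C \<and> P \<inter> L = {}} \<le> 2 ^ (card C - m)"
proof -
  have "{P. P \<subseteq> C \<and> P \<inter> L = {}} = Pow (C - L)" by auto
  moreover have "card (C - L) \<le> card C - m"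
    using assms by (simp add: card_Diff_subset finite_subset diff_le_mono2)
  ultimately show ?thesis
    using assms(1) by (simp add: card_Pow)
qed

text \<open>Complementation within \<open>C\<close> reduces this to the previous count.\<close>

lemma card_subsets_containing:
  assumes "finite C" "L \<subseteq> C" "m \<le> card L"
  shows "card {P. P \<subseteq> C \<and> L \<subseteq> P} \<le> 2 ^ (card C - m)"
proof -
  have "card {P. P \<subseteq> C \<and> L \<subseteq> P} \<le> card {P. P \<subseteq> C \<and> P \<inter> L = {}}"
    by (rule card_inj_on_le[where f = "\<lambda>P. C - P"])
      (use assms in \<open>auto simp: inj_on_def\<close>)
  then show ?thesis using card_subsets_avoiding[OF assms] by linarith
qed

text \<open>Reserve a set \<open>P\<close> of colors for \<open>A\<close> and the remaining colors
  for \<open>B\<close>; endpoints of an edge then never agree. Each vertex is left without a usable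
  color for at most a fraction \<open>1 / 2 ^ m\<close> of the sets \<open>P\<close>, so with fewer
  than \<open>2 ^ m\<close> vertices some \<open>P\<close> serves all.\<close>

lemma choosable_bipartite:
  assumes "finite A" "finite B" "A \<inter> B = {}" "card (A \<union> B) < 2 ^ m"
    "\<And>x y. {x, y} \<in> E \<Longrightarrow> x \<in> A \<and> y \<in> B \<or> x \<in> B \<and> y \<in> A"
  shows "choosable (A \<union> B) E m"
  unfolding choosable_def
proof (intro allI impI)
  fix L :: "'a \<Rightarrow> nat set" assume L: "\<forall>v\<in>A \<union> B. finite (L v) \<and> m \<le> card (L v)"
  define C where "C = \<Union>(L ` (A \<union> B))"
  have C: "finite C" "\<And>v. v \<in> A \<union> B \<Longrightarrow> L v \<subseteq> C"
    using assms(1,2) L by (auto simp: C_def)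
  \<comment> \<open>The splits that starve \<open>v\<close>: a vertex of \<open>A\<close> finds no
    list color in \<open>P\<close>, a vertex of \<open>B\<close> finds none outside
    \<open>P\<close>.\<close>
  define bad where
    "bad v = (if v \<in> A then {P. P \<subseteq> C \<and> P \<inter> L v = {}} else {P. P \<subseteq> C \<and> L v \<subseteq> P})" for v
  have "\<exists>P. P \<subseteq> C \<and> (\<forall>v\<in>A \<union> B. P \<notin> bad v)"
  proof (cases "A \<union> B = {}")
    case False
    \<comment> \<open>Any one list lies in \<open>C\<close>, so the exponent
      \<open>card C - m\<close> is not truncated.\<close>
    then have "m \<le> card C"
      using L C card_mono[OF C(1)] order_trans by (metis equals0I)
    have "card (\<Union>(bad ` (A \<union> B))) \<le> (\<Sum>v\<in>A \<union> B. card (bad v))"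
      using assms(1,2) by (intro card_UN_le) auto
    also have "\<dots> \<le> (\<Sum>v\<in>A \<union> B. 2 ^ (card C - m))"
      using L C by (intro sum_mono)
        (auto simp: bad_def intro!: card_subsets_avoiding card_subsets_containing)
    also have "\<dots> = card (A \<union> B) * 2 ^ (card C - m)" by simp
    also have "\<dots> < 2 ^ m * 2 ^ (card C - m)" using assms(4) by simp
    also have "\<dots> = card (Pow C)"
      using \<open>m \<le> card C\<close> C(1) by (simp add: card_Pow flip: power_add)
    finally have less: "card (\<Union>(bad ` (A \<union> B))) < card (Pow C)" .
    have "bad v \<subseteq> Pow C" for v unfolding bad_def by (cases "v \<in> A") auto
    then have "finite (\<Union>(bad ` (A \<union> B)))"
      using C(1) by (meson UN_least finite_Pow_iff finite_subset)
    then have "\<not> Pow C \<subseteq> \<Union>(bad ` (A \<union> B))"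
      using less card_mono leD by blast
    then show ?thesis by blast
  qed auto
  then obtain P where P: "P \<subseteq> C" "\<forall>v\<in>A \<union> B. P \<notin> bad v" by blast
  have "\<exists>a. a \<in> L v \<and> (a \<in> P \<longleftrightarrow> v \<in> A)" if "v \<in> A \<union> B" for v
    using P that by (auto simp: bad_def split: if_splits)
  then obtain \<phi> where \<phi>: "\<forall>v\<in>A \<union> B. \<phi> v \<in> L v \<and> (\<phi> v \<in> P \<longleftrightarrow> v \<in> A)" by metis
  have "proper_coloring E \<phi>"
    unfolding proper_coloring_def
  proof (intro allI impI)
    fix x y assume "{x, y} \<in> E"
    then show "\<phi> x \<noteq> \<phi> y" using assms(5)[of x y] assms(3) \<phi> by (metis IntI UnCI empty_iff)
  qed
  with \<phi> show "\<exists>\<phi>. (\<forall>v\<in>A \<union> B. \<phi> v \<in> L v) \<and> proper_coloring E \<phi>" by blast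
qed

section \<open>The separating graphs: balanced complete bipartite graphs and complete graphs\<close>

text \<open>By \<open>1 - x \<le> exp (- x)\<close> and \<open>q < exp q\<close>, the product is
  below the exponential of \<open>2 * n * q - n\<^sup>2 / q\<^sup>2\<close>. This exponent is
  nonpositive exactly when \<open>n\<close> is at least \<open>2 * q ^ 3\<close>, which explains the
  hypothesis.\<close>

lemma survivor_bound_balanced_bipartite:
  fixes n q :: nat
  assumes "1 \<le> q" "2 * q ^ 3 \<le> n"
  shows "(1 - 1 / (real q)\<^sup>2) ^ n\<^sup>2 * real q ^ (2 * n) < 1"
proof -
  have q: "0 < real q" and n: "0 < n"
    using assms by (auto simp: Suc_le_eq intro: less_le_trans[of _ "2 * q ^ 3"])
  have "(1 - 1 / (real q)\<^sup>2) ^ n\<^sup>2 \<le> exp (- 1 / (real q)\<^sup>2) ^ n\<^sup>2"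
    using assms(1) exp_ge_add_one_self[of "- 1 / (real q)\<^sup>2"] by (intro power_mono) auto
  also have "\<dots> = exp (- (real n)\<^sup>2 / (real q)\<^sup>2)"
    by (simp flip: exp_of_nat_mult)
  finally have 1: "(1 - 1 / (real q)\<^sup>2) ^ n\<^sup>2 \<le> exp (- (real n)\<^sup>2 / (real q)\<^sup>2)" .
  have "real q < exp (real q)" using exp_ge_add_one_self[of "real q"] by linarith
  then have "real q ^ (2 * n) < exp (real q) ^ (2 * n)"
    using n by (intro power_strict_mono) auto
  also have "\<dots> = exp (2 * n * real q)" by (simp flip: exp_of_nat_mult)
  finally have 2: "real q ^ (2 * n) < exp (2 * n * real q)" .
  have "(1 - 1 / (real q)\<^sup>2) ^ n\<^sup>2 * real q ^ (2 * n)
      \<le> exp (- (real n)\<^sup>2 / (real q)\<^sup>2) * real q ^ (2 * n)"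
    by (intro mult_right_mono 1) simp
  also have "\<dots> < exp (- (real n)\<^sup>2 / (real q)\<^sup>2) * exp (2 * n * real q)"
    by (intro mult_strict_left_mono 2) simp
  also have "\<dots> = exp (2 * n * real q - (real n)\<^sup>2 / (real q)\<^sup>2)"
    by (simp flip: exp_add)
  also have "\<dots> \<le> 1"
  proof -
    have "real (2 * q ^ 3) \<le> real n" using assms(2) of_nat_le_iff by blast
    then have "real n * (2 * real q ^ 3) \<le> real n * real n" by (intro mult_left_mono) auto
    then have "2 * n * real q \<le> (real n)\<^sup>2 / (real q)\<^sup>2"
      using q by (simp add: field_simps power2_eq_square power3_eq_cube)
    then show ?thesis by simp
  qed
  finally show ?thesis .
qed

lemma ex_conflict_exceeds_choice:
  "\<exists>(V :: nat set) E. simple_graph V E \<and>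
     choice_number V E + k \<le> single_conflict_chromatic_number V E"
proof -
  \<comment> \<open>A power of two makes the number of vertices, \<open>2 * n = 4 * Q ^ 3\<close>,
    equal to \<open>2 ^ (3 * (k + 5) + 2)\<close>, so lists of size \<open>3 * (k + 5) + 3\<close>
    suffice. The offset 5 ensures that this size plus \<open>k\<close>, namely
    \<open>4 * k + 18\<close>, is at most \<open>Q\<close>.\<close>
  define Q :: nat where "Q = 2 ^ (k + 5)"
  define n where "n = 2 * Q ^ 3"
  define A B where "A = {0..<n}" and "B = {n..<2 * n}"
  define E where "E = (\<lambda>(x, y). {x, y}) ` (A \<times> B)"
  have "0 < n" by (simp add: n_def Q_def)
  have AB: "A \<inter> B = {}" "finite A" "finite B" "A \<noteq> {}"
    using \<open>0 < n\<close> by (auto simp: A_def B_def)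
  have card_V: "card (A \<union> B) = 2 * n"
    using AB by (simp add: card_Un_disjoint) (simp add: A_def B_def)
  have "inj_on (\<lambda>(x, y). {x, y}) (A \<times> B)"
    using AB(1) by (auto simp: inj_on_def doubleton_eq_iff)
  then have card_E: "card E = n\<^sup>2"
    unfolding E_def by (simp add: card_image card_cartesian_product power2_eq_square A_def B_def)
  have graph: "simple_graph (A \<union> B) E"
    using AB by (auto simp: simple_graph_def E_def card_2_iff)
  have "Q < single_conflict_chromatic_number (A \<union> B) E"
  proof (rule single_conflict_chromatic_number_gt[OF graph])
    fix q assume "1 \<le> q" "q \<le> Q"
    \<comment> \<open>Fixing \<open>n\<close> by the largest value \<open>Q\<close> covers all
      smaller \<open>q\<close> at once.\<close>
    then have "2 * q ^ 3 \<le> n" by (simp add: n_def power_mono)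
    then show "(1 - 1 / (real q)\<^sup>2) ^ card E * real q ^ card (A \<union> B) < 1"
      unfolding card_E card_V using \<open>1 \<le> q\<close> by (intro survivor_bound_balanced_bipartite)
  qed
  moreover have "choosable (A \<union> B) E (3 * (k + 5) + 3)"
  proof (rule choosable_bipartite)
    have "2 * n = 2 ^ (3 * (k + 5) + 2)"
      by (simp add: n_def Q_def flip: power_mult) (simp add: power_add mult.commute)
    also have "\<dots> < (2::nat) ^ (3 * (k + 5) + 3)" by (rule power_strict_increasing) auto
    finally show "card (A \<union> B) < 2 ^ (3 * (k + 5) + 3)" by (simp add: card_V)
  qed (use AB in \<open>auto simp: E_def doubleton_eq_iff\<close>)
  then have "choice_number (A \<union> B) E \<le> 3 * (k + 5) + 3"
    unfolding choice_number_def by (rule Least_le)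
  moreover have "4 * k + 18 \<le> Q" unfolding Q_def by (induction k) (simp_all add: power_add)
  ultimately show ?thesis using graph by (intro exI[of _ "A \<union> B"] exI[of _ E]) simp
qed

text \<open>The complete graph on \<open>4 * k\<close> vertices has at most
  \<open>8 * k\<^sup>2\<close> edges, fewer than \<open>(3 * k)\<^sup>2 = 9 * k\<^sup>2\<close>. The
  gap of \<open>k\<close> is the difference between \<open>4 * k\<close> and
  \<open>3 * k\<close>.\<close>

lemma ex_choice_exceeds_conflict:
  assumes "1 \<le> k"
  shows "\<exists>(V :: nat set) E. simple_graph V E \<and>
    single_conflict_chromatic_number V E + k \<le> choice_number V E"
proof -
  define V where "V = {0..<4 * k}"
  define E where "E = {e. e \<subseteq> V \<and> card e = 2}"
  have V: "finite V" "V \<noteq> {}" "card V = 4 * k" using assms by (auto simp: V_def)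
  have graph: "simple_graph V E" using V by (auto simp: simple_graph_def E_def)
  have "card E = 4 * k * (4 * k - 1) div 2"
    unfolding E_def using n_subsets[OF V(1)] by (simp add: V(3) choose_two)
  also have "\<dots> \<le> 4 * k * (4 * k) div 2" by (intro div_le_mono mult_le_mono) auto
  also have "\<dots> < (3 * k)\<^sup>2" using assms by (simp add: power2_eq_square)
  finally have "single_conflict_chromatic_number V E \<le> 3 * k"
    by (rule single_conflict_chromatic_number_le[OF graph])
  moreover have "4 * k \<le> choice_number V E"
    using choice_number_complete_graph_ge[OF V(1,2)] by (simp add: E_def V(3))
  ultimately show ?thesis using graph by (intro exI[of _ V] exI[of _ E]) simp
qed

theorem proposition1p1:
  fixes k :: nat
  assumes "k \<ge> 1"
  shows "\<exists>(VG :: nat set) (EG :: nat set set) (VH :: nat set) (EH :: nat set set).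
           simple_graph VG EG \<and> simple_graph VH EH \<and>
           int (single_conflict_chromatic_number VG EG) - int (choice_number VG EG) \<ge> int k \<and>
           int (choice_number VH EH) - int (single_conflict_chromatic_number VH EH) \<ge> int k"
proof -
  obtain VG :: "nat set" and EG where "simple_graph VG EG"
    "choice_number VG EG + k \<le> single_conflict_chromatic_number VG EG"
    using ex_conflict_exceeds_choice by blast
  moreover obtain VH :: "nat set" and EH where "simple_graph VH EH"
    "single_conflict_chromatic_number VH EH + k \<le> choice_number VH EH"
    using ex_choice_exceeds_conflict[OF assms] by blast
  ultimately show ?thesis
    by (rule_tac x = VG in exI, rule_tac x = EG in exI, rule_tac x = VH in exI, rule_tac x = EH in exI) simp
qed

end
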